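(* Let $\Omega\subset\mathbb{C}$ be a simply connected domain, let $h:\Omega\to\mathbb{R}$ be a harmonic function and let $L,P:\Omega\to\mathbb{C}$ be two holomorphic functions such that $$(h_z)^2=L_z\,P_z\qquad\text{and}\qquad |L_z|-|P_z|\neq 0$$ at every point of $\Omega$. Then the map $\psi:\Omega\to\mathbb{C}\times\mathbb{R}$ given by $\psi(z)=(L(z)+\overline{P(z)},\,h(z))$ defines a conformal spacelike minimal immersion into the Lorentz-Minkowski space $\mathbb{L}^3$.
   Context: $\mathbb{L}^3$ is $\mathbb{R}^3$ endowed with the Lorentzian metric $g=dx_1^2+dx_2^2-dx_3^2$, identified with $\mathbb{C}\times\mathbb{R}$ by $(x_1,x_2,x_3)\leftrightarrow(x_1+i\,x_2,\,x_3)$. Write $z=u+i\,v$; subscripts $z$ denote the complex operator $\frac{\partial}{\partial z}=\frac12\left(\frac{\partial}{\partial u}-i\,\frac{\partial}{\partial v}\right)$ (so $L_z=L'$, $P_z=P'$), and harmonic means $h_{uu}+h_{vv}=0$. An immersion $\psi:\Omega\to\mathbb{L}^3$ is spacelike if the induced metric $ds^2=\psi^*g$ is Riemannian. It is conformal if $z=u+i\,v$ is an isothermal coordinate for $ds^2$, i.e. $g(\psi_u,\psi_u)=g(\psi_v,\psi_v)$ and $g(\psi_u,\psi_v)=0$. It is minimal if its mean curvature $H$ (the trace of the second fundamental form with respect to the first fundamental form, computed with a unit normal field $N$, $g(N,N)=-1$) vanishes identically. *)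

theory Defs
  imports "HOL-Analysis.Analysis"
begin

(* Partial derivatives with respect to u and v, where z = u + i v. They are only meaningful
   where f is real differentiable. *)

definition pd_u :: "(complex \<Rightarrow> 'b::real_normed_vector) \<Rightarrow> complex \<Rightarrow> 'b" where
  "pd_u f z = frechet_derivative f (at z) 1"

definition pd_v :: "(complex \<Rightarrow> 'b::real_normed_vector) \<Rightarrow> complex \<Rightarrow> 'b" where
  "pd_v f z = frechet_derivative f (at z) \<i>"

(* Class C^k in the real sense; intended for open S. *)

primrec C_k_on :: "nat \<Rightarrow> (complex \<Rightarrow> 'b::real_normed_vector) \<Rightarrow> complex set \<Rightarrow> bool" where
  "C_k_on 0 f S \<longleftrightarrow> continuous_on S f"
| "C_k_on (Suc k) f S \<longleftrightarrow>
     (\<forall>z\<in>S. f differentiable (at z)) \<and> C_k_on k (pd_u f) S \<and> C_k_on k (pd_v f) S"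

definition smooth_on :: "(complex \<Rightarrow> 'b::real_normed_vector) \<Rightarrow> complex set \<Rightarrow> bool" where
  "smooth_on f S \<longleftrightarrow> (\<forall>k. C_k_on k f S)"

definition harmonic_on :: "(complex \<Rightarrow> real) \<Rightarrow> complex set \<Rightarrow> bool" where
  "harmonic_on h S \<longleftrightarrow>
     C_k_on 2 h S \<and> (\<forall>z\<in>S. pd_u (pd_u h) z + pd_v (pd_v h) z = 0)"

(* The operator d/dz; a real-valued function is first composed with complex_of_real. *)

definition d_dz :: "(complex \<Rightarrow> complex) \<Rightarrow> complex \<Rightarrow> complex" where
  "d_dz f z = (pd_u f z - \<i> * pd_v f z) / 2"

(* The metric of L^3 under (x1, x2, x3) = (x1 + i x2, x3). *)

definition lorentz :: "complex \<times> real \<Rightarrow> complex \<times> real \<Rightarrow> real" where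
  "lorentz x y = Re (fst x) * Re (fst y) + Im (fst x) * Im (fst y) - snd x * snd y"

definition immersion_on :: "(complex \<Rightarrow> complex \<times> real) \<Rightarrow> complex set \<Rightarrow> bool" where
  "immersion_on \<psi> S \<longleftrightarrow> smooth_on \<psi> S \<and> (\<forall>z\<in>S. inj (frechet_derivative \<psi> (at z)))"

definition induced_metric ::
    "(complex \<Rightarrow> complex \<times> real) \<Rightarrow> complex \<Rightarrow> complex \<Rightarrow> complex \<Rightarrow> real" where
  "induced_metric \<psi> z X Y =
     lorentz (frechet_derivative \<psi> (at z) X) (frechet_derivative \<psi> (at z) Y)"

definition spacelike_on :: "(complex \<Rightarrow> complex \<times> real) \<Rightarrow> complex set \<Rightarrow> bool" where
  "spacelike_on \<psi> S \<longleftrightarrow> (\<forall>z\<in>S. \<forall>X. X \<noteq> 0 \<longrightarrow> induced_metric \<psi> z X X > 0)"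

definition conformal_on :: "(complex \<Rightarrow> complex \<times> real) \<Rightarrow> complex set \<Rightarrow> bool" where
  "conformal_on \<psi> S \<longleftrightarrow>
     (\<forall>z\<in>S. lorentz (pd_u \<psi> z) (pd_u \<psi> z) = lorentz (pd_v \<psi> z) (pd_v \<psi> z) \<and>
             lorentz (pd_u \<psi> z) (pd_v \<psi> z) = 0)"

definition unit_normal_field_on ::
    "(complex \<Rightarrow> complex \<times> real) \<Rightarrow> (complex \<Rightarrow> complex \<times> real) \<Rightarrow> complex set \<Rightarrow> bool" where
  "unit_normal_field_on \<psi> N S \<longleftrightarrow> smooth_on N S \<and>
     (\<forall>z\<in>S. lorentz (N z) (N z) = -1 \<and>
             lorentz (N z) (pd_u \<psi> z) = 0 \<and> lorentz (N z) (pd_v \<psi> z) = 0)"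

(* Matrices of the two fundamental forms in the basis d/du, d/dv; the second fundamental form
   is II(X, Y) = g(D_X d\<psi>(Y), N), with D the flat connection of L^3. *)

definition first_fundamental_form ::
    "(complex \<Rightarrow> complex \<times> real) \<Rightarrow> complex \<Rightarrow> real ^ 2 ^ 2" where
  "first_fundamental_form \<psi> z =
     vector [vector [lorentz (pd_u \<psi> z) (pd_u \<psi> z), lorentz (pd_u \<psi> z) (pd_v \<psi> z)],
             vector [lorentz (pd_v \<psi> z) (pd_u \<psi> z), lorentz (pd_v \<psi> z) (pd_v \<psi> z)]]"

definition second_fundamental_form ::
    "(complex \<Rightarrow> complex \<times> real) \<Rightarrow> (complex \<Rightarrow> complex \<times> real) \<Rightarrow> complex \<Rightarrow> real ^ 2 ^ 2" where
  "second_fundamental_form \<psi> N z =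
     vector [vector [lorentz (pd_u (pd_u \<psi>) z) (N z), lorentz (pd_u (pd_v \<psi>) z) (N z)],
             vector [lorentz (pd_v (pd_u \<psi>) z) (N z), lorentz (pd_v (pd_v \<psi>) z) (N z)]]"

definition mean_curvature ::
    "(complex \<Rightarrow> complex \<times> real) \<Rightarrow> (complex \<Rightarrow> complex \<times> real) \<Rightarrow> complex \<Rightarrow> real" where
  "mean_curvature \<psi> N z =
     trace (matrix_inv (first_fundamental_form \<psi> z) ** second_fundamental_form \<psi> N z)"

(* For a spacelike immersion of a domain the unit normal field is unique up to sign, and
   replacing N by -N changes the sign of the mean curvature, so the choice of N is immaterial.
   The existential also asserts that a unit normal field exists, so that the condition is
   never vacuous. *)

definition minimal_on :: "(complex \<Rightarrow> complex \<times> real) \<Rightarrow> complex set \<Rightarrow> bool" where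
  "minimal_on \<psi> S \<longleftrightarrow>
     (\<exists>N. unit_normal_field_on \<psi> N S \<and> (\<forall>z\<in>S. mean_curvature \<psi> N z = 0))"

end

theory Submission
  imports Defs "HOL-Complex_Analysis.Cauchy_Integral_Formula"
begin

text \<open>Put \<open>a = L'\<close>, \<open>b = P'\<close> and \<open>\<phi> = h\<^sub>z\<close>. Then \<open>d\<psi>(X) = (a X + cnj (b X), 2 Re (\<phi> X))\<close>, and
  \<open>\<phi>\<^sup>2 = a b\<close> gives \<open>g(d\<psi>(X), d\<psi>(X)) = (\<bar>a\<bar> - \<bar>b\<bar>)\<^sup>2 \<bar>X\<bar>\<^sup>2\<close>; so \<open>\<psi>\<close> is a conformal spacelike
  immersion. In isothermal coordinates the mean curvature is a multiple of
  \<open>g(\<psi>\<^sub>u\<^sub>u + \<psi>\<^sub>v\<^sub>v, N)\<close>, which vanishes because \<open>L\<close>, \<open>P\<close> and \<open>\<phi>\<close> are holomorphic.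
  Holomorphy of \<open>\<phi>\<close> is read off from that of \<open>\<phi>\<^sup>2 = a b\<close>, which avoids the symmetry of
  second derivatives.\<close>

section \<open>Real partial derivatives and classes C^k\<close>

lemma pd_eqI:
  assumes "(f has_derivative f') (at z)"
  shows "pd_u f z = f' 1" "pd_v f z = f' \<i>"
  using frechet_derivative_at[OF assms] by (simp_all add: pd_u_def pd_v_def)

lemma frechet_derivative_eq_pd:
  assumes "f differentiable (at z)"
  shows "frechet_derivative f (at z) X = Re X *\<^sub>R pd_u f z + Im X *\<^sub>R pd_v f z"
proof -
  interpret linear "frechet_derivative f (at z)"
    by (rule linear_frechet_derivative[OF assms])
  have "X = Re X *\<^sub>R 1 + Im X *\<^sub>R \<i>"
    by (simp add: complex_eq_iff)
  then have "frechet_derivative f (at z) X =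
      frechet_derivative f (at z) (Re X *\<^sub>R 1 + Im X *\<^sub>R \<i>)"
    by (rule arg_cong)
  then show ?thesis
    by (simp only: add scale pd_u_def pd_v_def)
qed

lemma has_derivative_pd:
  assumes "f differentiable (at z)"
  shows "(f has_derivative (\<lambda>X. Re X *\<^sub>R pd_u f z + Im X *\<^sub>R pd_v f z)) (at z)"
  using assms frechet_derivative_works[of f "at z"]
  by (simp add: frechet_derivative_eq_pd[OF assms, symmetric])

lemma pd_cong:
  assumes "open S" "z \<in> S" "\<And>w. w \<in> S \<Longrightarrow> f w = g w" "f differentiable (at z)"
  shows "pd_u f z = pd_u g z" "pd_v f z = pd_v g z"
  using frechet_derivative_transform_within_open[OF assms(4,1,2,3)]
  by (simp_all add: pd_u_def pd_v_def)

text \<open>Derivatives at a point of an open set see only nearby values. This matters because the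
  derivative formulas used below hold on \<open>S\<close> alone, not as equations of
  functions.\<close>

lemma C_k_on_cong:
  assumes "open S" "\<And>z. z \<in> S \<Longrightarrow> f z = g z" "C_k_on k f S"
  shows "C_k_on k g S"
  using assms(2,3)
proof (induction k arbitrary: f g)
  case 0
  then show ?case
    using continuous_on_cong[of S S f g] by simp
next
  case (Suc k)
  have "g differentiable (at z)" if "z \<in> S" for z
  proof -
    have "(f has_derivative frechet_derivative f (at z)) (at z)"
      using Suc.prems that by (simp add: frechet_derivative_works)
    then show ?thesis
      using has_derivative_transform_within_open[OF _ assms(1) that] Suc.prems(1)
      by (meson differentiableI)
  qed
  moreover have "pd_u f z = pd_u g z" "pd_v f z = pd_v g z" if "z \<in> S" for z
    using pd_cong[OF assms(1) that Suc.prems(1)] Suc.prems(2) that by simp_all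
  then have "C_k_on k (pd_u g) S" "C_k_on k (pd_v g) S"
    using Suc.IH[of "pd_u f" "pd_u g"] Suc.IH[of "pd_v f" "pd_v g"] Suc.prems(2) by simp_all
  ultimately show ?case by simp
qed

lemma C_k_on_Suc_imp: "C_k_on (Suc k) f S \<Longrightarrow> C_k_on k f S"
proof (induction k arbitrary: f)
  case 0
  then show ?case
    by (auto intro!: continuous_at_imp_continuous_on differentiable_imp_continuous_within)
next
  case (Suc k)
  from Suc.prems have "C_k_on k (pd_u f) S" "C_k_on k (pd_v f) S"
    unfolding C_k_on.simps(2)[of "Suc k"] by (simp_all only: Suc.IH)
  with Suc.prems show ?case by simp
qed

text \<open>Drives the closure proofs: once an explicit derivative is known, it only remains to show
  that its values at \<open>1\<close> and \<open>\<i>\<close> are of class C^k.\<close>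

lemma C_k_on_SucI:
  assumes "open S"
    and "\<And>z. z \<in> S \<Longrightarrow> (f has_derivative f' z) (at z)"
    and "C_k_on k (\<lambda>z. f' z 1) S" "C_k_on k (\<lambda>z. f' z \<i>) S"
  shows "C_k_on (Suc k) f S"
proof -
  have "C_k_on k (pd_u f) S"
    by (rule C_k_on_cong[OF assms(1) _ assms(3)]) (simp add: pd_eqI(1)[OF assms(2)])
  moreover have "C_k_on k (pd_v f) S"
    by (rule C_k_on_cong[OF assms(1) _ assms(4)]) (simp add: pd_eqI(2)[OF assms(2)])
  ultimately show ?thesis
    using differentiableI[OF assms(2)] by simp
qed

lemma C_k_on_const: "C_k_on k (\<lambda>_. c) S"
proof (induction k arbitrary: c)
  case (Suc k)
  have "pd_u (\<lambda>_. c) = (\<lambda>_. 0)" "pd_v (\<lambda>_. c) = (\<lambda>_. 0)"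
    by (simp_all add: pd_u_def pd_v_def fun_eq_iff)
  then show ?case using Suc by simp
qed simp

lemma C_k_on_add:
  assumes "open S" "C_k_on k f S" "C_k_on k g S"
  shows "C_k_on k (\<lambda>z. f z + g z) S"
  using assms(2,3)
proof (induction k arbitrary: f g)
  case 0
  then show ?case by (simp add: continuous_on_add)
next
  case (Suc k)
  have "C_k_on k (\<lambda>z. pd_u f z + pd_u g z) S" "C_k_on k (\<lambda>z. pd_v f z + pd_v g z) S"
    using Suc.prems by (simp_all add: Suc.IH)
  then show ?case
    using Suc.prems
    by (intro C_k_on_SucI[OF assms(1) has_derivative_add[OF has_derivative_pd has_derivative_pd]])
       simp_all
qed

lemma (in bounded_linear) C_k_on:
  assumes "open S" "C_k_on k g S"
  shows "C_k_on k (\<lambda>z. f (g z)) S"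
  using assms(2)
proof (induction k arbitrary: g)
  case 0
  then show ?case by (simp add: continuous_on)
next
  case (Suc k)
  have "C_k_on k (\<lambda>z. f (pd_u g z)) S" "C_k_on k (\<lambda>z. f (pd_v g z)) S"
    using Suc.prems by (simp_all add: Suc.IH)
  then show ?case
    using Suc.prems
    by (intro C_k_on_SucI[OF assms(1) has_derivative[OF has_derivative_pd]]) simp_all
qed

lemma (in bounded_bilinear) C_k_on:
  assumes "open S" "C_k_on k f S" "C_k_on k g S"
  shows "C_k_on k (\<lambda>z. prod (f z) (g z)) S"
  using assms(2,3)
proof (induction k arbitrary: f g)
  case 0
  then show ?case by (simp add: continuous_on)
next
  case (Suc k)
  \<comment> \<open>The product rule contains \<open>f\<close> and \<open>g\<close>
    undifferentiated, so the induction hypothesis needs them at the lower level \<open>k\<close>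
    too.\<close>
  then have "C_k_on k f S" "C_k_on k g S"
    by (blast intro: C_k_on_Suc_imp)+
  then have "C_k_on k (\<lambda>z. prod (f z) (pd_u g z) + prod (pd_u f z) (g z)) S"
      "C_k_on k (\<lambda>z. prod (f z) (pd_v g z) + prod (pd_v f z) (g z)) S"
    using Suc.prems by (simp_all add: C_k_on_add[OF assms(1) Suc.IH Suc.IH])
  then show ?case
    using Suc.prems
    by (intro C_k_on_SucI[OF assms(1) FDERIV[OF has_derivative_pd has_derivative_pd]]) simp_all
qed

lemmas C_k_on_mult = bounded_bilinear.C_k_on[OF bounded_bilinear_mult]
lemmas C_k_on_scaleR = bounded_bilinear.C_k_on[OF bounded_bilinear_scaleR]
lemmas C_k_on_minus = bounded_linear.C_k_on[OF bounded_linear_minus[OF bounded_linear_ident]]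

lemma C_k_on_diff:
  assumes "open S" "C_k_on k f S" "C_k_on k g S"
  shows "C_k_on k (\<lambda>z. f z - g z) S"
  using C_k_on_add[OF assms(1,2) C_k_on_minus[OF assms(1,3)]] by simp

text \<open>The squared modulus is a polynomial in the real and imaginary parts, so zeros of
  \<open>f\<close> cause no trouble, unlike for \<open>cmod\<close> itself.\<close>

lemma C_k_on_cmod_power2:
  assumes "open S" "C_k_on k f S"
  shows "C_k_on k (\<lambda>z. (cmod (f z))\<^sup>2) S"
  unfolding cmod_power2 unfolding power2_eq_square
  by (intro C_k_on_add C_k_on_mult bounded_linear.C_k_on[OF bounded_linear_Re]
        bounded_linear.C_k_on[OF bounded_linear_Im] assms)

text \<open>The derivative of \<open>1/f\<close> is a product of \<open>1/f\<close>, a partial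
  derivative of \<open>f\<close> and \<open>1/f\<close>, so regularity of \<open>1/f\<close>
  bootstraps by one level at a time.\<close>

lemma C_k_on_inverse:
  fixes f :: "complex \<Rightarrow> 'a::real_normed_field"
  assumes "open S" "C_k_on k f S" "\<And>z. z \<in> S \<Longrightarrow> f z \<noteq> 0"
  shows "C_k_on k (\<lambda>z. inverse (f z)) S"
  using assms(2)
proof (induction k)
  case 0
  then show ?case using assms(3) by (simp add: continuous_on_inverse)
next
  case (Suc k)
  then have "C_k_on k (\<lambda>z. inverse (f z)) S"
    by (blast intro: C_k_on_Suc_imp)
  then have "C_k_on k (\<lambda>z. - (inverse (f z) * pd_u f z * inverse (f z))) S"
      "C_k_on k (\<lambda>z. - (inverse (f z) * pd_v f z * inverse (f z))) S"
    using Suc.prems by (simp_all add: C_k_on_minus C_k_on_mult assms(1))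
  then show ?case
    using Suc.prems
    by (intro C_k_on_SucI[OF assms(1)
          Deriv.has_derivative_inverse[OF assms(3) has_derivative_pd]]) simp_all
qed

lemma C_k_on_Pair:
  assumes "open S" "C_k_on k f S" "C_k_on k g S"
  shows "C_k_on k (\<lambda>z. (f z, g z)) S"
proof -
  have "bounded_linear (\<lambda>x::'a. (x, 0::'b))" "bounded_linear (\<lambda>x::'b. (0::'a, x))"
    by (simp_all add: bounded_linear_Pair bounded_linear_ident bounded_linear_zero)
  then have "C_k_on k (\<lambda>z. (f z, 0) + (0, g z)) S"
    by (intro C_k_on_add bounded_linear.C_k_on[of "\<lambda>x. (x, 0)"]
          bounded_linear.C_k_on[of "\<lambda>x. (0, x)"] assms)
  then show ?thesis by simp
qed

section \<open>Holomorphic functions and the Cauchy-Riemann equations\<close>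

lemma holomorphic_on_has_derivative:
  assumes "f holomorphic_on S" "open S" "z \<in> S"
  shows "(f has_derivative (\<lambda>X. deriv f z * X)) (at z)"
  using holomorphic_derivI[OF assms] by (simp add: has_field_derivative_def)

lemma holomorphic_on_pd:
  assumes "f holomorphic_on S" "open S" "z \<in> S"
  shows "pd_u f z = deriv f z" "pd_v f z = \<i> * deriv f z"
  using pd_eqI[OF holomorphic_on_has_derivative[OF assms]] by simp_all

lemma holomorphic_on_d_dz:
  assumes "f holomorphic_on S" "open S" "z \<in> S"
  shows "d_dz f z = deriv f z"
  using holomorphic_on_pd[OF assms] by (simp add: d_dz_def)

lemma C_k_on_holomorphic:
  assumes "f holomorphic_on S" "open S"
  shows "C_k_on k f S"
  using assms(1)
proof (induction k arbitrary: f)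
  case 0
  then show ?case by (simp add: holomorphic_on_imp_continuous_on)
next
  case (Suc k)
  show ?case
    using Suc.prems assms(2)
    by (intro C_k_on_SucI[OF assms(2) holomorphic_on_has_derivative[OF Suc.prems assms(2)]])
       (auto intro!: Suc.IH holomorphic_intros)
qed

text \<open>With \<open>p_v = i p_u\<close> the real derivative \<open>Re X p_u + Im X p_v\<close>
  collapses to complex multiplication by \<open>p_u\<close>.\<close>

lemma holomorphic_on_if_cauchy_riemann:
  assumes "open S" "\<And>z. z \<in> S \<Longrightarrow> p differentiable (at z)"
    and "\<And>z. z \<in> S \<Longrightarrow> pd_v p z = \<i> * pd_u p z"
  shows "p holomorphic_on S"
proof (rule holomorphic_onI)
  fix z assume z: "z \<in> S"
  have "(\<lambda>X. Re X *\<^sub>R pd_u p z + Im X *\<^sub>R pd_v p z) = (*) (pd_u p z)"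
    using assms(3)[OF z] by (auto simp: fun_eq_iff complex_eq_iff)
  then have "(p has_field_derivative pd_u p z) (at z)"
    using has_derivative_pd[OF assms(2)[OF z]] by (simp add: has_field_derivative_def)
  then show "p field_differentiable (at z within S)"
    using field_differentiable_at_within field_differentiable_def by blast
qed

text \<open>The product of \<open>p\<close> with its Cauchy--Riemann defect \<open>p\<^sub>v - i p\<^sub>u\<close> vanishes. Near a point
  where the defect is nonzero, \<open>p\<close> would thus be zero, and so would be the defect.\<close>

lemma holomorphic_on_if_square_holomorphic:
  assumes "open S" "C_k_on 1 p S" "(\<lambda>z. (p z)\<^sup>2) holomorphic_on S"
  shows "p holomorphic_on S"
proof (rule holomorphic_on_if_cauchy_riemann[OF assms(1)])
  show diff: "p differentiable (at z)" if "z \<in> S" for z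
    using assms(2) that by simp
  define d where "d = (\<lambda>z. pd_v p z - \<i> * pd_u p z)"
  have cont: "continuous_on S d"
    using assms(2) unfolding d_def by (auto intro!: continuous_intros)
  have prod0: "p z * d z = 0" if z: "z \<in> S" for z
  proof -
    have "((\<lambda>z. (p z)\<^sup>2) has_derivative
        (\<lambda>X. 2 * p z * (Re X *\<^sub>R pd_u p z + Im X *\<^sub>R pd_v p z))) (at z)"
      by (rule has_derivative_eq_rhs[OF has_derivative_power[OF has_derivative_pd[OF diff[OF z]]]])
         (simp add: algebra_simps)
    from pd_eqI[OF this]
    have "pd_u (\<lambda>z. (p z)\<^sup>2) z = 2 * p z * pd_u p z"
        "pd_v (\<lambda>z. (p z)\<^sup>2) z = 2 * p z * pd_v p z" by simp_all
    \<comment> \<open>The Cauchy-Riemann equation of the holomorphic function \<open>p^2\<close>,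
      expanded by the chain rule.\<close>
    then have "2 * p z * pd_v p z = \<i> * (2 * p z * pd_u p z)"
      using holomorphic_on_pd[OF assms(3,1) z] by metis
    then show ?thesis by (auto simp: d_def)
  qed
  fix z assume z: "z \<in> S"
  have "d z = 0"
  proof (rule ccontr)
    assume nz: "d z \<noteq> 0"
    \<comment> \<open>The C^1 assumption makes \<open>d\<close> continuous, so the set where it does
      not vanish is open.\<close>
    define U where "U = S \<inter> d -` (- {0})"
    have U: "open U" "z \<in> U"
      using continuous_open_preimage[OF cont assms(1), of "- {0}"] z nz by (auto simp: U_def)
    have p0: "p w = 0" if "w \<in> U" for w
      using prod0[of w] that by (auto simp: U_def)
    have "(p has_derivative (\<lambda>_. 0)) (at z)"
      by (rule has_derivative_transform_within_open[OF has_derivative_const[of 0] U])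
         (simp add: p0)
    from pd_eqI[OF this] nz show False by (simp add: d_def)
  qed
  then show "pd_v p z = \<i> * pd_u p z" by (simp add: d_def)
qed

section \<open>The Lorentzian metric\<close>

lemma lorentz_commute: "lorentz x y = lorentz y x"
  by (simp add: lorentz_def mult.commute)

lemma lorentz_add_left: "lorentz (x + y) w = lorentz x w + lorentz y w"
  by (simp add: lorentz_def algebra_simps)

text \<open>This uses \<open>4 (Re w)\<^sup>2 = 2 \<bar>w\<bar>\<^sup>2 + 2 Re (w\<^sup>2)\<close>.\<close>

lemma lorentz_tangent_self:
  assumes "w\<^sup>2 = a * b"
  shows "lorentz (a + cnj b, 2 * Re w) (a + cnj b, 2 * Re w) = (cmod a - cmod b)\<^sup>2"
proof -
  have "(cmod w)\<^sup>2 = cmod a * cmod b"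
    using assms by (metis norm_mult norm_power)
  moreover have "(Re w)\<^sup>2 - (Im w)\<^sup>2 = Re a * Re b - Im a * Im b"
    using arg_cong[OF assms, of Re] by (simp add: power2_eq_square)
  moreover have "(cmod w)\<^sup>2 = (Re w)\<^sup>2 + (Im w)\<^sup>2"
      "(cmod a)\<^sup>2 = (Re a)\<^sup>2 + (Im a)\<^sup>2" "(cmod b)\<^sup>2 = (Re b)\<^sup>2 + (Im b)\<^sup>2"
    by (simp_all add: cmod_power2)
  ultimately show ?thesis
    by (simp add: lorentz_def power2_eq_square algebra_simps)
qed

section \<open>Mean curvature in isothermal coordinates\<close>

lemma matrix_mult_mat_left:
  fixes B :: "'a::semiring_1^'m^'n"
  shows "(mat c ** B) $ i $ j = c * B $ i $ j"
proof -
  have "(mat c ** B) $ i $ j = (\<Sum>k\<in>UNIV. if k = i then c * B $ k $ j else 0)"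
    unfolding matrix_matrix_mult_def mat_def vec_lambda_beta by (rule sum.cong) auto
  then show ?thesis by simp
qed

lemma trace_matrix_inv_scalar:
  fixes B :: "real^'n^'n"
  assumes "c \<noteq> 0"
  shows "trace (matrix_inv (mat c) ** B) = trace B / c"
proof -
  have mm: "mat x ** (mat y :: real^'n^'n) = mat (x * y)" for x y
    by (simp add: vec_eq_iff matrix_mult_mat_left) (simp add: mat_def)
  let ?I = "matrix_inv (mat c) :: real^'n^'n"
  \<comment> \<open>\<open>matrix_inv\<close> is defined by choice; its inverse property is
    available only after a two-sided inverse has been exhibited.\<close>
  have "\<exists>A :: real^'n^'n. mat c ** A = mat 1 \<and> A ** mat c = mat 1"
    using assms by (intro exI[of _ "mat (1 / c)"]) (simp add: mm)
  from someI_ex[OF this] have "mat c ** ?I = mat 1"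
    by (simp add: matrix_inv_def)
  then have "mat (1 / c) ** (mat c ** ?I) = (mat (1 / c) :: real^'n^'n)" by simp
  then have "?I = mat (1 / c)"
    using assms by (simp add: matrix_mul_assoc mm)
  then show ?thesis
    by (simp add: trace_def matrix_mult_mat_left sum_divide_distrib)
qed

text \<open>The first fundamental form is a scalar matrix here, so its inverse merely divides the
  trace of the second form; the mixed second derivatives drop out.\<close>

lemma mean_curvature_conformal:
  assumes "lorentz (pd_u \<psi> z) (pd_u \<psi> z) = lorentz (pd_v \<psi> z) (pd_v \<psi> z)"
    and "lorentz (pd_u \<psi> z) (pd_v \<psi> z) = 0" and "lorentz (pd_u \<psi> z) (pd_u \<psi> z) \<noteq> 0"
  shows "mean_curvature \<psi> N z =
    lorentz (pd_u (pd_u \<psi>) z + pd_v (pd_v \<psi>) z) (N z) / lorentz (pd_u \<psi> z) (pd_u \<psi> z)"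
proof -
  have "first_fundamental_form \<psi> z = mat (lorentz (pd_u \<psi> z) (pd_u \<psi> z))"
    using assms(1,2)
    by (simp add: first_fundamental_form_def mat_def vec_eq_iff forall_2
          lorentz_commute[of "pd_v \<psi> z" "pd_u \<psi> z"])
  then have "mean_curvature \<psi> N z =
      trace (second_fundamental_form \<psi> N z) / lorentz (pd_u \<psi> z) (pd_u \<psi> z)"
    using assms(3) by (simp add: mean_curvature_def trace_matrix_inv_scalar)
  then show ?thesis
    by (simp add: second_fundamental_form_def lorentz_add_left trace_def sum_2)
qed

text \<open>The unit normal is the normalised Lorentzian cross product of the tangent vectors
  \<open>(a + cnj b, 2 Re w)\<close> and \<open>(i (a - cnj b), - 2 Im w)\<close>. The denominator is \<open>(\<bar>a\<bar> - \<bar>b\<bar>)\<^sup>2\<close> when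
  \<open>w\<^sup>2 = a b\<close>, but is written so that it is visibly smooth where \<open>a\<close> or \<open>b\<close> vanishes.\<close>

definition weierstrass_normal :: "complex \<Rightarrow> complex \<Rightarrow> complex \<Rightarrow> complex \<times> real" where
  "weierstrass_normal a b w =
     inverse ((cmod a)\<^sup>2 + (cmod b)\<^sup>2 - 2 * (cmod w)\<^sup>2) *\<^sub>R
       (2 * (cnj w * a - w * cnj b), (cmod a)\<^sup>2 - (cmod b)\<^sup>2)"

lemma weierstrass_normal_denominator:
  assumes "w\<^sup>2 = a * b"
  shows "(cmod a)\<^sup>2 + (cmod b)\<^sup>2 - 2 * (cmod w)\<^sup>2 = (cmod a - cmod b)\<^sup>2"
proof -
  have "(cmod w)\<^sup>2 = cmod a * cmod b"
    using assms by (metis norm_mult norm_power)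
  then show ?thesis by (simp add: power2_diff)
qed

text \<open>An arbitrary direction \<open>X\<close> treats both tangent vectors at once:
  \<open>X = 1\<close> gives \<open>pd_u\<close> and \<open>X = \<i>\<close> gives
  \<open>pd_v\<close>.\<close>

lemma lorentz_weierstrass_normal:
  assumes "w\<^sup>2 = a * b"
  shows "lorentz (weierstrass_normal a b w) (a * X + cnj (b * X), 2 * Re (w * X)) = 0"
proof -
  have ww: "w * w = a * b" using assms by (simp add: power2_eq_square)
  have "Re (cnj (cnj w * a - w * cnj b) * (a * X + cnj (b * X)))
      = ((cmod a)\<^sup>2 - (cmod b)\<^sup>2) * Re (w * X)"
  proof -
    have "cnj (cnj w * a - w * cnj b) * (a * X + cnj (b * X)) =
        (a * cnj a) * (w * X) - (b * cnj b) * cnj (w * X)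
        + (w * cnj (a * b) * cnj X - cnj w * (a * b) * X)"
      by (simp add: algebra_simps)
    \<comment> \<open>Replacing \<open>a b\<close> by \<open>w^2\<close> turns the remaining terms
      into a real multiple of \<open>cnj (w X) - w X\<close>, which is purely imaginary and
      disappears from the real part.\<close>
    also have "w * cnj (a * b) * cnj X - cnj w * (a * b) * X =
        (w * cnj w) * (cnj (w * X) - w * X)"
      unfolding ww[symmetric] by (simp add: algebra_simps)
    finally have eq: "cnj (cnj w * a - w * cnj b) * (a * X + cnj (b * X)) =
        of_real ((cmod a)\<^sup>2) * (w * X) - of_real ((cmod b)\<^sup>2) * cnj (w * X)
        + of_real ((cmod w)\<^sup>2) * (cnj (w * X) - w * X)"
      unfolding complex_norm_square .
    have "Re (of_real A * u - of_real B * cnj u + of_real C * (cnj u - u)) = (A - B) * Re u"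
      for A B C u by (simp add: algebra_simps)
    then show ?thesis unfolding eq .
  qed
  moreover have "lorentz (r *\<^sub>R (2 * q, t)) (y, 2 * x) = 2 * r * (Re (cnj q * y) - t * x)"
    for r t x q y
    by (simp add: lorentz_def algebra_simps)
  ultimately show ?thesis
    by (simp only: weierstrass_normal_def) simp
qed

text \<open>With denominator \<open>D = (|a| - |b|)^2\<close>, the unnormalised vector has
  Lorentzian square \<open>4 |a||b| D - (|a|^2 - |b|^2)^2\<close>. Factoring out \<open>D\<close>
  leaves \<open>4 |a||b| - (|a| + |b|)^2 = - D\<close>, so the square is
  \<open>- D^2\<close>.\<close>

lemma lorentz_weierstrass_normal_self:
  assumes "w\<^sup>2 = a * b" "cmod a \<noteq> cmod b"
  shows "lorentz (weierstrass_normal a b w) (weierstrass_normal a b w) = -1"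
proof -
  define D where "D = (cmod a)\<^sup>2 + (cmod b)\<^sup>2 - 2 * (cmod w)\<^sup>2"
  have w: "(cmod w)\<^sup>2 = cmod a * cmod b"
    using assms(1) by (metis norm_mult norm_power)
  have D: "D \<noteq> 0"
    using assms(2) by (simp add: D_def weierstrass_normal_denominator[OF assms(1)])
  have c: "(cmod (cnj w * a - w * cnj b))\<^sup>2 = (cmod w)\<^sup>2 * D"
  proof -
    have ww: "a * b = w * w" using assms(1) by (simp add: power2_eq_square)
    have "complex_of_real ((cmod (cnj w * a - w * cnj b))\<^sup>2) =
        (w * cnj w) * (a * cnj a + b * cnj b) - cnj w * cnj w * (a * b) - w * w * cnj (a * b)"
      unfolding complex_norm_square by (simp add: algebra_simps)
    also have "\<dots> = (w * cnj w) * (a * cnj a + b * cnj b - 2 * (w * cnj w))"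
      unfolding ww by (simp add: algebra_simps)
    also have "\<dots> = complex_of_real ((cmod w)\<^sup>2 * D)"
      by (simp add: D_def complex_norm_square flip: of_real_power)
    finally show ?thesis by (simp only: of_real_eq_iff)
  qed
  have "lorentz (r *\<^sub>R (2 * q, t)) (r *\<^sub>R (2 * q, t)) = r\<^sup>2 * (4 * (cmod q)\<^sup>2 - t\<^sup>2)"
    for r q t
    unfolding lorentz_def cmod_power2 by (simp add: power2_eq_square algebra_simps)
  then have "lorentz (weierstrass_normal a b w) (weierstrass_normal a b w) =
      (inverse D)\<^sup>2 * (4 * (cmod (cnj w * a - w * cnj b))\<^sup>2 - ((cmod a)\<^sup>2 - (cmod b)\<^sup>2)\<^sup>2)"
    by (simp only: weierstrass_normal_def D_def)
  also have "4 * (cmod (cnj w * a - w * cnj b))\<^sup>2 - ((cmod a)\<^sup>2 - (cmod b)\<^sup>2)\<^sup>2 = - (D\<^sup>2)"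
    unfolding c D_def w by (simp add: power2_eq_square algebra_simps)
  also have "(inverse D)\<^sup>2 * - (D\<^sup>2) = -1"
    using D by (simp add: field_simps)
  finally show ?thesis .
qed

lemma smooth_on_weierstrass_normal:
  assumes "open S" "smooth_on a S" "smooth_on b S" "smooth_on w S"
    and "\<And>z. z \<in> S \<Longrightarrow> (w z)\<^sup>2 = a z * b z" "\<And>z. z \<in> S \<Longrightarrow> cmod (a z) \<noteq> cmod (b z)"
  shows "smooth_on (\<lambda>z. weierstrass_normal (a z) (b z) (w z)) S"
proof -
  have "(cmod (a z))\<^sup>2 + (cmod (b z))\<^sup>2 - 2 * (cmod (w z))\<^sup>2 \<noteq> 0" if z: "z \<in> S" for z
    using assms(6)[OF z] by (simp add: weierstrass_normal_denominator[OF assms(5)[OF z]])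
  then show ?thesis
    using assms(1-4) unfolding smooth_on_def weierstrass_normal_def
    by (intro allI C_k_on_scaleR C_k_on_inverse C_k_on_Pair C_k_on_diff C_k_on_add C_k_on_mult
          C_k_on_const C_k_on_cmod_power2 bounded_linear.C_k_on[OF bounded_linear_cnj]) blast+
qed

section \<open>The surface determined by \<open>L\<close>, \<open>P\<close> and
  \<open>h\<close>\<close>

theorem theorem4p1:
  fixes \<Omega> :: "complex set" and h :: "complex \<Rightarrow> real" and L P :: "complex \<Rightarrow> complex"
    and \<psi> :: "complex \<Rightarrow> complex \<times> real"
  assumes "open \<Omega>" and "connected \<Omega>" and "\<Omega> \<noteq> {}" and "simply_connected \<Omega>"
    and "harmonic_on h \<Omega>" and "L holomorphic_on \<Omega>" and "P holomorphic_on \<Omega>"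
    and "\<And>z. z \<in> \<Omega> \<Longrightarrow> (d_dz (\<lambda>w. complex_of_real (h w)) z)\<^sup>2 = d_dz L z * d_dz P z"
    and "\<And>z. z \<in> \<Omega> \<Longrightarrow> cmod (d_dz L z) - cmod (d_dz P z) \<noteq> 0"
    and "\<And>z. z \<in> \<Omega> \<Longrightarrow> \<psi> z = (L z + cnj (P z), h z)"
  shows "immersion_on \<psi> \<Omega> \<and> spacelike_on \<psi> \<Omega> \<and> conformal_on \<psi> \<Omega> \<and> minimal_on \<psi> \<Omega>"
proof -
  note op = assms(1)
  define a b where "a = deriv L" and "b = deriv P"
  \<comment> \<open>This is \<open>h_z\<close>, written directly in terms of the real partial
    derivatives of \<open>h\<close>.\<close>
  define \<phi> where "\<phi> = (\<lambda>z. Complex (pd_u h z / 2) (- pd_v h z / 2))"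
  have hol: "a holomorphic_on \<Omega>" "b holomorphic_on \<Omega>"
    unfolding a_def b_def using assms(6,7) op by (auto intro: holomorphic_intros)
  have h2: "\<And>z. z \<in> \<Omega> \<Longrightarrow> h differentiable (at z)"
      "C_k_on 1 (pd_u h) \<Omega>" "C_k_on 1 (pd_v h) \<Omega>"
    using assms(5) by (auto simp: harmonic_on_def numeral_2_eq_2)
  have "d_dz (\<lambda>w. complex_of_real (h w)) z = \<phi> z" if "z \<in> \<Omega>" for z
  proof -
    have "((\<lambda>w. complex_of_real (h w)) has_derivative
        (\<lambda>X. of_real (Re X *\<^sub>R pd_u h z + Im X *\<^sub>R pd_v h z))) (at z)"
      by (rule has_derivative_of_real[OF has_derivative_pd[OF h2(1)[OF that]]])
    from pd_eqI[OF this] show ?thesis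
      by (simp add: d_dz_def \<phi>_def complex_eq_iff)
  qed
  then have sq: "(\<phi> z)\<^sup>2 = a z * b z" and neq: "cmod (a z) \<noteq> cmod (b z)" if "z \<in> \<Omega>" for z
    using assms(8,9)[OF that] that holomorphic_on_d_dz[OF assms(6) op] 
      holomorphic_on_d_dz[OF assms(7) op] by (simp_all add: a_def b_def)
  have \<phi>_eq: "\<phi> = (\<lambda>z. of_real (pd_u h z / 2) - \<i> * of_real (pd_v h z / 2))"
    by (simp add: \<phi>_def complex_eq_iff fun_eq_iff)
  have "C_k_on 1 \<phi> \<Omega>"
    using h2 op unfolding \<phi>_eq divide_inverse
    by (intro C_k_on_diff C_k_on_mult C_k_on_const bounded_linear.C_k_on[OF bounded_linear_of_real])
       auto
  moreover have "(\<lambda>z. (\<phi> z)\<^sup>2) holomorphic_on \<Omega>"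
    using hol sq holomorphic_cong[of \<Omega> \<Omega> "\<lambda>z. (\<phi> z)\<^sup>2" "\<lambda>z. a z * b z"]
    by (simp add: holomorphic_on_mult)
  ultimately have hol\<phi>: "\<phi> holomorphic_on \<Omega>"
    by (rule holomorphic_on_if_square_holomorphic[OF op])

  have der: "(\<psi> has_derivative (\<lambda>X. (a z * X + cnj (b z * X), 2 * Re (\<phi> z * X)))) (at z)"
    if z: "z \<in> \<Omega>" for z
  proof (rule has_derivative_transform_within_open[OF _ op z])
    show "((\<lambda>z. (L z + cnj (P z), h z)) has_derivative
        (\<lambda>X. (a z * X + cnj (b z * X), 2 * Re (\<phi> z * X)))) (at z)"
      using has_derivative_Pair[OF
          has_derivative_add[OF holomorphic_on_has_derivative[OF assms(6) op z]
             has_derivative_cnj[OF holomorphic_on_has_derivative[OF assms(7) op z]]]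
          has_derivative_pd[OF h2(1)[OF z]]]
      by (rule has_derivative_eq_rhs) (simp add: a_def b_def \<phi>_def fun_eq_iff algebra_simps)
  qed (simp add: assms(10))
  have frechet: "frechet_derivative \<psi> (at z) = (\<lambda>X. (a z * X + cnj (b z * X), 2 * Re (\<phi> z * X)))"
    if "z \<in> \<Omega>" for z
    using frechet_derivative_at[OF der[OF that]] by simp
  have pd: "pd_u \<psi> z = (a z + cnj (b z), 2 * Re (\<phi> z))"
      "pd_v \<psi> z = (\<i> * (a z - cnj (b z)), - 2 * Im (\<phi> z))" if "z \<in> \<Omega>" for z
    using pd_eqI[OF der[OF that]] by (simp_all add: algebra_simps)

  have metric: "induced_metric \<psi> z X X = (cmod (a z) - cmod (b z))\<^sup>2 * (cmod X)\<^sup>2"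
    if z: "z \<in> \<Omega>" for z X
  proof -
    \<comment> \<open>The relation between \<open>\<phi>\<close>, \<open>a\<close> and
      \<open>b\<close> survives multiplication of all three by \<open>X\<close>, so one identity for
      the squared length covers every direction.\<close>
    have "(\<phi> z * X)\<^sup>2 = (a z * X) * (b z * X)"
      using sq[OF z] by (simp add: power2_eq_square)
    from lorentz_tangent_self[OF this] show ?thesis
      by (simp add: induced_metric_def frechet[OF z] norm_mult power2_eq_square algebra_simps)
  qed
  have spacelike: "spacelike_on \<psi> \<Omega>"
    using neq by (simp add: spacelike_on_def metric)

  have smooth: "smooth_on \<psi> \<Omega>"
    unfolding smooth_on_def
  proof
    fix k
    note cs = C_k_on_holomorphic[OF hol(1) op] C_k_on_holomorphic[OF hol(2) op]
      C_k_on_holomorphic[OF hol\<phi> op]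
    show "C_k_on k \<psi> \<Omega>"
      \<comment> \<open>Harmonicity supplies only class C^2 for \<open>h\<close>. The coefficients
        of the derivative of \<open>\<psi>\<close> are holomorphic, however, so
        \<open>\<psi>\<close> is even of class C^(k+1).\<close>
      by (rule C_k_on_Suc_imp, rule C_k_on_SucI[OF op der], assumption;
          intro C_k_on_Pair C_k_on_add C_k_on_mult C_k_on_const
            bounded_linear.C_k_on[OF bounded_linear_Re]
            bounded_linear.C_k_on[OF bounded_linear_cnj] op cs)
  qed
  have "inj (frechet_derivative \<psi> (at z))" if z: "z \<in> \<Omega>" for z
  proof -
    interpret linear "frechet_derivative \<psi> (at z)"
      using der[OF z] by (intro linear_frechet_derivative) (rule differentiableI)
    \<comment> \<open>A vector in the kernel has induced length zero, and the induced metric is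
      definite.\<close>
    have "X = 0" if "frechet_derivative \<psi> (at z) X = 0" for X
      using metric[OF z, of X] neq[OF z] that by (simp add: induced_metric_def lorentz_def)
    then show ?thesis by (simp add: linear_injective_0 linear_axioms)
  qed
  with smooth have immersion: "immersion_on \<psi> \<Omega>"
    by (simp add: immersion_on_def)

  have E: "lorentz (pd_u \<psi> z) (pd_u \<psi> z) = (cmod (a z) - cmod (b z))\<^sup>2"
      "lorentz (pd_v \<psi> z) (pd_v \<psi> z) = (cmod (a z) - cmod (b z))\<^sup>2" if "z \<in> \<Omega>" for z
    using metric[OF that, of 1] metric[OF that, of \<i>]
    by (simp_all add: induced_metric_def pd_u_def pd_v_def)
  \<comment> \<open>Expanded, the product is twice the imaginary part of
    \<open>\<phi>^2 - a b\<close>.\<close>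
  have F: "lorentz (pd_u \<psi> z) (pd_v \<psi> z) = 0" if z: "z \<in> \<Omega>" for z
    using arg_cong[OF sq[OF z], of Im] by (simp add: pd[OF z] lorentz_def power2_eq_square algebra_simps)
  have conformal: "conformal_on \<psi> \<Omega>"
    by (simp add: conformal_on_def E F)

  \<comment> \<open>Differentiating the formulas for \<open>pd_u \<psi>\<close> and
    \<open>pd_v \<psi>\<close> in the directions \<open>1\<close> and \<open>\<i>\<close> gives
    opposite vectors, since the two factors \<open>\<i>\<close> combine to
    \<open>-1\<close>.\<close>
  have lap\<psi>: "pd_u (pd_u \<psi>) z + pd_v (pd_v \<psi>) z = 0" if z: "z \<in> \<Omega>" for z
  proof -
    note d = holomorphic_on_has_derivative[OF hol(1) op z]
      holomorphic_on_has_derivative[OF hol(2) op z] holomorphic_on_has_derivative[OF hol\<phi> op z]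
    have "(pd_u \<psi> has_derivative
        (\<lambda>X. (deriv a z * X + cnj (deriv b z * X), 2 * Re (deriv \<phi> z * X)))) (at z)"
      by (rule has_derivative_transform_within_open[OF _ op z pd(1)[symmetric]])
         (auto intro!: derivative_eq_intros d)
    moreover have "(pd_v \<psi> has_derivative
        (\<lambda>X. (\<i> * (deriv a z * X - cnj (deriv b z * X)), - 2 * Im (deriv \<phi> z * X)))) (at z)"
      by (rule has_derivative_transform_within_open[OF _ op z pd(2)[symmetric]])
         (auto intro!: derivative_eq_intros d)
    ultimately show ?thesis
      by (simp add: pd_eqI algebra_simps prod_eq_iff)
  qed
  define N where "N = (\<lambda>z. weierstrass_normal (a z) (b z) (\<phi> z))"
  have "smooth_on N \<Omega>"
    unfolding N_def using op hol hol\<phi> sq neq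
    by (intro smooth_on_weierstrass_normal) (auto simp: smooth_on_def C_k_on_holomorphic)
  moreover have "lorentz (N z) (pd_u \<psi> z) = 0 \<and> lorentz (N z) (pd_v \<psi> z) = 0" if z: "z \<in> \<Omega>" for z
    using lorentz_weierstrass_normal[OF sq[OF z], of 1] lorentz_weierstrass_normal[OF sq[OF z], of \<i>]
    by (simp add: pd_u_def pd_v_def frechet[OF z] N_def)
  moreover have "lorentz (N z) (N z) = -1" if z: "z \<in> \<Omega>" for z
    unfolding N_def by (rule lorentz_weierstrass_normal_self[OF sq[OF z] neq[OF z]])
  ultimately have "unit_normal_field_on \<psi> N \<Omega>"
    by (simp add: unit_normal_field_on_def)
  moreover have "mean_curvature \<psi> N z = 0" if z: "z \<in> \<Omega>" for z
  proof -
    have "lorentz 0 (N z) = 0" by (simp add: lorentz_def)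
    then show ?thesis
      using neq[OF z] by (simp add: mean_curvature_conformal E[OF z] F[OF z] lap\<psi>[OF z])
  qed
  ultimately have "minimal_on \<psi> \<Omega>"
    unfolding minimal_on_def by blast
  with immersion spacelike conformal show ?thesis by simp
qed

end
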